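(* Let $K$ be a field, let $m,n,t$ be positive integers with $t\le m$, $t\le n$, let $X=(x_{ij})$ be an $m\times n$ matrix of indeterminates, and let $I_t\subseteq K[X]$ be the ideal generated by all $t\times t$ minors of $X$. Then $I_t$ contains no nonzero polynomial with at most $t!/2$ terms; equivalently, the shortness of $I_t$ is at least $t!/2+1$.
   Context: $K[X]$ denotes the polynomial ring over $K$ in the $mn$ indeterminates $x_{ij}$. The number of terms of a polynomial is the number of monomials appearing in it with nonzero coefficient. The shortness of an ideal $I$ is the minimal $s$ such that $I$ contains a nonzero polynomial with at most $s$ terms. *)

theory Defs
  imports "HOL-Library.Poly_Mapping" "HOL-Library.Cardinality" "Jordan_Normal_Form.Determinant"
begin

text \<open>Polynomial ring K[X] over a field K in the indeterminates x_ij, where the row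
  index i ranges over a finite type 'm (so m = CARD('m)) and the column index j over a
  finite type 'n (n = CARD('n)).  A polynomial is a finitely supported map from
  monomials (finitely supported exponent vectors) to coefficients.\<close>

type_synonym ('m, 'n, 'k) mpoly = "(('m \<times> 'n) \<Rightarrow>\<^sub>0 nat) \<Rightarrow>\<^sub>0 'k"

definition var :: "'m \<Rightarrow> 'n \<Rightarrow> ('m, 'n, 'k::comm_ring_1) mpoly" where
  "var i j = Poly_Mapping.single (Poly_Mapping.single (i, j) 1) 1"

definition num_terms :: "('a \<Rightarrow>\<^sub>0 'k::zero) \<Rightarrow> nat" where
  "num_terms p = card (Poly_Mapping.keys p)"

definition minor :: "nat \<Rightarrow> (nat \<Rightarrow> 'm) \<Rightarrow> (nat \<Rightarrow> 'n) \<Rightarrow> ('m, 'n, 'k::comm_ring_1) mpoly" where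
  "minor t r c = det (mat t t (\<lambda>(a, b). var (r a) (c b)))"

text \<open>The set of all t x t minors of X (selections of t distinct rows and t distinct
  columns; the order of the selection only affects the sign).\<close>
definition minors :: "nat \<Rightarrow> ('m, 'n, 'k::comm_ring_1) mpoly set" where
  "minors t = {minor t r c | r c. inj_on r {..<t} \<and> inj_on c {..<t}}"

definition gen_ideal :: "'a::comm_ring_1 set \<Rightarrow> 'a set" where
  "gen_ideal G = {\<Sum>g\<in>F. h g * g | F h. finite F \<and> F \<subseteq> G}"

end

theory Submission
  imports Defs
begin

text \<open>A polynomial in the ideal vanishes on all matrices of rank at most \<open>t - 1\<close>, over an infinite
  extension field. Such a nonzero polynomial has at least \<open>t!\<close> terms, by induction on \<open>t\<close> and on the
  number of rows. Sort its terms by the monomial \<open>y^\<alpha>\<close> in the last row \<open>y\<close>, with coefficients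
  \<open>f\<^sub>\<alpha>\<close> in the other rows. Each \<open>f\<^sub>\<alpha>\<close> vanishes on rank at most \<open>t - 2\<close>, so it has at least
  \<open>(t - 1)!\<close> terms. Unless all \<open>f\<^sub>\<alpha>\<close> vanish on rank at most \<open>t - 1\<close> (then drop the row), there are
  at least \<open>t\<close> of them, because \<open>t - 1\<close> distinct monomials are linearly independent on a generic
  \<open>(t - 1)\<close>-dimensional space.\<close>

section \<open>Functions that are polynomial along lines\<close>

text \<open>Polynomiality is required only along lines, where a nonzero univariate polynomial has
  finitely many roots. Sums, products and coordinate functions stay in this class, so functions on
  matrices can be treated without a multivariate polynomial behind them.\<close>

definition line_poly :: "(('i \<Rightarrow> 'l) \<Rightarrow> 'l::field) \<Rightarrow> bool" where
  "line_poly g \<longleftrightarrow> (\<forall>x y. \<exists>q. \<forall>s. g (\<lambda>i. x i + s * (y i - x i)) = poly q s)"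

lemma line_poly_const: "line_poly (\<lambda>_. c)"
  unfolding line_poly_def by (auto intro!: exI[of _ "[:c:]"])

lemma line_poly_coord: "line_poly (\<lambda>x. x i)"
  unfolding line_poly_def
proof (intro allI)
  fix x y :: "'a \<Rightarrow> 'b"
  show "\<exists>q. \<forall>s. x i + s * (y i - x i) = poly q s"
    by (rule exI[of _ "[:x i, y i - x i:]"]) simp
qed

lemma line_poly_add:
  assumes "line_poly g" and "line_poly h"
  shows "line_poly (\<lambda>x. g x + h x)"
  unfolding line_poly_def
proof (intro allI)
  fix x y :: "'a \<Rightarrow> 'b"
  obtain p q where "\<forall>s. g (\<lambda>i. x i + s * (y i - x i)) = poly p s"
    and "\<forall>s. h (\<lambda>i. x i + s * (y i - x i)) = poly q s"
    using assms unfolding line_poly_def by meson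
  then show "\<exists>r. \<forall>s. g (\<lambda>i. x i + s * (y i - x i)) + h (\<lambda>i. x i + s * (y i - x i)) = poly r s"
    by (intro exI[of _ "p + q"]) simp
qed

lemma line_poly_mult:
  assumes "line_poly g" and "line_poly h"
  shows "line_poly (\<lambda>x. g x * h x)"
  unfolding line_poly_def
proof (intro allI)
  fix x y :: "'a \<Rightarrow> 'b"
  obtain p q where "\<forall>s. g (\<lambda>i. x i + s * (y i - x i)) = poly p s"
    and "\<forall>s. h (\<lambda>i. x i + s * (y i - x i)) = poly q s"
    using assms unfolding line_poly_def by meson
  then show "\<exists>r. \<forall>s. g (\<lambda>i. x i + s * (y i - x i)) * h (\<lambda>i. x i + s * (y i - x i)) = poly r s"
    by (intro exI[of _ "p * q"]) simp
qed

lemma line_poly_sum: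
  assumes "\<And>a. a \<in> A \<Longrightarrow> line_poly (g a)"
  shows "line_poly (\<lambda>x. \<Sum>a\<in>A. g a x)"
  using assms
  by (induction A rule: infinite_finite_induct) (auto intro: line_poly_const line_poly_add)

lemma line_poly_prod:
  assumes "\<And>a. a \<in> A \<Longrightarrow> line_poly (g a)"
  shows "line_poly (\<lambda>x. \<Prod>a\<in>A. g a x)"
  using assms
  by (induction A rule: infinite_finite_induct) (auto intro: line_poly_const line_poly_mult)

lemma line_poly_power: "line_poly g \<Longrightarrow> line_poly (\<lambda>x. g x ^ n)"
  by (induction n) (auto intro: line_poly_const line_poly_mult)

lemmas line_poly_intros =
  line_poly_const line_poly_coord line_poly_add line_poly_mult line_poly_sum line_poly_prod
  line_poly_power

text \<open>Plays the part of an irreducible variety: over an infinite field, two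
  \<open>line_poly\<close> functions, neither identically zero on the set, have a common point of
  nonvanishing there.\<close>

definition line_closed :: "('i \<Rightarrow> 'l::field) set \<Rightarrow> bool" where
  "line_closed W \<longleftrightarrow> (\<forall>x\<in>W. \<forall>y\<in>W. \<forall>s. (\<lambda>i. x i + s * (y i - x i)) \<in> W)"

text \<open>On the line through \<open>u\<close> and \<open>v\<close> the two functions become
  univariate polynomials, nonzero at 0 and at 1 respectively. Their product is nonzero, so some
  element of the infinite field is not a root of it.\<close>

lemma common_nonzero:
  fixes g h :: "('i \<Rightarrow> 'l::field) \<Rightarrow> 'l"
  assumes inf: "infinite (UNIV :: 'l set)" and W: "line_closed W"
    and g: "line_poly g" "u \<in> W" "g u \<noteq> 0" and h: "line_poly h" "v \<in> W" "h v \<noteq> 0"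
  obtains w where "w \<in> W" and "g w \<noteq> 0" and "h w \<noteq> 0"
proof -
  let ?p = "\<lambda>s i. u i + s * (v i - u i)"
  obtain p q where p: "\<And>s. g (?p s) = poly p s" and q: "\<And>s. h (?p s) = poly q s"
    using g(1) h(1) unfolding line_poly_def by meson
  have "poly p 0 \<noteq> 0" "poly q 1 \<noteq> 0"
    using p[of 0] q[of 1] g(3) h(3) by auto
  then have "p * q \<noteq> 0" by auto
  then have "finite {s. poly (p * q) s = 0}" by (rule poly_roots_finite)
  then obtain s where "poly (p * q) s \<noteq> 0"
    using inf by (metis (mono_tags, lifting) UNIV_eq_I mem_Collect_eq)
  with p[of s] q[of s] W g(2) h(2) show thesis
    by (intro that[of "?p s"]) (auto simp: line_closed_def)
qed

lemma common_nonzero_family: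
  fixes g :: "'a \<Rightarrow> ('i \<Rightarrow> 'l::field) \<Rightarrow> 'l"
  assumes inf: "infinite (UNIV :: 'l set)" and W: "line_closed W" "W \<noteq> {}" and fin: "finite A"
    and g: "\<And>a. a \<in> A \<Longrightarrow> line_poly (g a)" "\<And>a. a \<in> A \<Longrightarrow> \<exists>u\<in>W. g a u \<noteq> 0"
  shows "\<exists>w\<in>W. \<forall>a\<in>A. g a w \<noteq> 0"
  using fin g
proof (induction A)
  case empty
  then show ?case using W(2) by auto
next
  case (insert a A)
  then obtain v where v: "v \<in> W" "\<forall>a\<in>A. g a v \<noteq> 0" by auto
  obtain u where u: "u \<in> W" "g a u \<noteq> 0" using insert.prems(2) by auto
  have "line_poly (\<lambda>x. \<Prod>a\<in>A. g a x)"
    using insert.prems(1) by (auto intro: line_poly_intros)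
  then obtain w where "w \<in> W" "g a w \<noteq> 0" "(\<Prod>a\<in>A. g a w) \<noteq> 0"
    using common_nonzero[OF inf W(1), of "g a" u "\<lambda>x. \<Prod>a\<in>A. g a x" v] u v insert.prems(1)
      insert.hyps(1) by auto
  then show ?case using insert.hyps(1) by auto
qed

section \<open>Independence of few monomials on a generic subspace\<close>

text \<open>For a linear subspace this says that its coordinate functions form a uniform matroid of
  rank at least \<open>k\<close> (or a free one).\<close>

definition uniform_on :: "nat \<Rightarrow> 'n set \<Rightarrow> ('n \<Rightarrow> 'l::field) set \<Rightarrow> bool" where
  "uniform_on k J W \<longleftrightarrow>
    (\<forall>I j. I \<subseteq> J \<longrightarrow> card I < k \<longrightarrow> j \<in> J - I \<longrightarrow> (\<exists>w\<in>W. (\<forall>i\<in>I. w i = 0) \<and> w j \<noteq> 0))"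

text \<open>If the exponents of \<open>w i\<close> are not all equal, cancel the common power of \<open>w i\<close> and restrict to
  \<open>w i = 0\<close>: fewer monomials survive, and the rank drops by only one.\<close>

lemma few_monomials_independent:
  fixes W :: "('n \<Rightarrow> 'l::field) set" and c :: "('n \<Rightarrow> nat) \<Rightarrow> 'l"
  assumes inf: "infinite (UNIV :: 'l set)"
    and "finite J" and "line_closed W" and "(\<lambda>_. 0) \<in> W" and "uniform_on k J W"
    and "finite T" and "T \<noteq> {}" and "card T \<le> k"
    and "\<And>a b. a \<in> T \<Longrightarrow> b \<in> T \<Longrightarrow> a \<noteq> b \<Longrightarrow> \<exists>j\<in>J. a j \<noteq> b j"
    and "\<And>a. a \<in> T \<Longrightarrow> c a \<noteq> 0"
  shows "\<exists>w\<in>W. (\<Sum>a\<in>T. c a * (\<Prod>j\<in>J. w j ^ a j)) \<noteq> 0"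
  using assms(2-)
proof (induction k arbitrary: J W T)
  case 0
  then show ?case by auto
next
  case (Suc k)
  note fJ = Suc.prems(1) and W = Suc.prems(2,3) and U = Suc.prems(4) and fT = Suc.prems(5)
    and dist = Suc.prems(8) and c = Suc.prems(9)
  have coord: "\<exists>w\<in>W. w j \<noteq> 0" if "j \<in> J" for j
    using U[unfolded uniform_on_def, rule_format, of "{}" j] that by auto
  show ?case
  proof (cases "\<exists>a\<in>T. \<exists>b\<in>T. a \<noteq> b")
    \<comment> \<open>A single monomial is nonzero wherever all coordinates are nonzero.\<close>
    case False
    then obtain a where T: "T = {a}" using Suc.prems(6) by blast
    have "\<exists>w\<in>W. \<forall>j\<in>J. w j \<noteq> 0"
      using common_nonzero_family[OF inf W(1) _ fJ, of "\<lambda>j w. w j"] W(2) coord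
      by (auto intro: line_poly_intros)
    then show ?thesis using T c fJ by auto
  next
    case True
    then obtain a b i where ab: "a \<in> T" "b \<in> T" "i \<in> J" "a i \<noteq> b i"
      using dist by meson
    define m where "m = Min ((\<lambda>a. a i) ` T)"
    have m_le: "m \<le> a i" if "a \<in> T" for a using that fT by (auto simp: m_def)
    have "m \<in> (\<lambda>a. a i) ` T" unfolding m_def using fT ab by (intro Min_in) auto
    then obtain a0 where a0: "a0 \<in> T" "a0 i = m" by auto
    define T0 where "T0 = {a\<in>T. a i = m}"
    define h where "h = (\<lambda>w. \<Sum>a\<in>T. c a * (w i ^ (a i - m) * (\<Prod>j\<in>J-{i}. w j ^ a j)))"
    define W0 where "W0 = {w\<in>W. w i = 0}"
    have split: "(\<Sum>a\<in>T. c a * (\<Prod>j\<in>J. w j ^ a j)) = w i ^ m * h w" for w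
      unfolding h_def sum_distrib_left
    proof (rule sum.cong)
      fix a assume "a \<in> T"
      then have "w i ^ a i = w i ^ m * w i ^ (a i - m)"
        using m_le by (simp flip: power_add)
      then show "c a * (\<Prod>j\<in>J. w j ^ a j) =
          w i ^ m * (c a * (w i ^ (a i - m) * (\<Prod>j\<in>J - {i}. w j ^ a j)))"
        using prod.remove[OF fJ ab(3), of "\<lambda>j. w j ^ a j"] by (simp add: mult_ac)
    qed simp
    \<comment> \<open>Since \<open>a i\<close> and \<open>b i\<close> differ, they are not both the
      minimum \<open>m\<close>; hence \<open>T0\<close> has at most \<open>k\<close>
      elements.\<close>
    have "\<not> T \<subseteq> T0" using ab by (auto simp: T0_def)
    then have "card T0 < card T" using fT by (intro psubset_card_mono) (auto simp: T0_def)
    moreover have "uniform_on k (J - {i}) W0"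
      unfolding uniform_on_def
    proof (intro allI impI)
      fix I j assume *: "I \<subseteq> J - {i}" "card I < k" "j \<in> J - {i} - I"
      \<comment> \<open>Prescribing a zero at \<open>i\<close> in addition to those on
        \<open>I\<close> costs exactly one unit of rank.\<close>
      have "card (insert i I) < Suc k"
        using * by (simp add: card_insert_if finite_subset[OF *(1)] fJ)
      then obtain w where "w \<in> W" "\<forall>l\<in>insert i I. w l = 0" "w j \<noteq> 0"
        using U[unfolded uniform_on_def, rule_format, of "insert i I" j] * ab(3) by auto
      then show "\<exists>w\<in>W0. (\<forall>i\<in>I. w i = 0) \<and> w j \<noteq> 0" by (auto simp: W0_def)
    qed
    moreover have "line_closed W0" "(\<lambda>_. 0) \<in> W0"
      using W by (auto simp: line_closed_def W0_def)
    moreover have "\<exists>j\<in>J-{i}. a j \<noteq> b j" if "a \<in> T0" "b \<in> T0" "a \<noteq> b" for a b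
      using dist[of a b] that by (auto simp: T0_def)
    ultimately obtain w where w: "w \<in> W0"
      and nz: "(\<Sum>a\<in>T0. c a * (\<Prod>j\<in>J-{i}. w j ^ a j)) \<noteq> 0"
      using Suc.IH[of "J - {i}" W0 T0] fJ fT a0 Suc.prems(7) c by (auto simp: T0_def)
    have "h w = (\<Sum>a\<in>T0. c a * (\<Prod>j\<in>J-{i}. w j ^ a j))"
      unfolding h_def T0_def sum.inter_filter[OF fT]
    proof (rule sum.cong)
      fix a assume "a \<in> T"
      then show "c a * (w i ^ (a i - m) * (\<Prod>j\<in>J - {i}. w j ^ a j)) =
          (if a i = m then c a * (\<Prod>j\<in>J - {i}. w j ^ a j) else 0)"
        using w m_le[of a] by (auto simp: W0_def)
    qed simp
    \<comment> \<open>At \<open>w\<close> the factor \<open>w i ^ m\<close> may vanish, because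
      \<open>w i = 0\<close>. It remains to find another point of \<open>W\<close> where both
      \<open>h\<close> and the coordinate \<open>i\<close> are nonzero.\<close>
    then have "h w \<noteq> 0" using nz by simp
    moreover have "line_poly h" unfolding h_def by (intro line_poly_intros)
    moreover obtain u where "u \<in> W" "u i \<noteq> 0" using coord ab(3) by auto
    ultimately obtain v where "v \<in> W" "v i \<noteq> 0" "h v \<noteq> 0"
      using common_nonzero[OF inf W(1) line_poly_coord[of i], of u h w] w by (auto simp: W0_def)
    then show ?thesis using split[of v] by (intro bexI[of _ v]) auto
  qed
qed

text \<open>The full space is uniform of every rank, so the preceding lemma applies with
  \<open>k\<close> equal to the number of nonzero coefficients.\<close>

lemma monomials_independent:
  fixes c :: "('n::finite \<Rightarrow> nat) \<Rightarrow> 'l::field"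
  assumes inf: "infinite (UNIV :: 'l set)" and fin: "finite T"
    and zero: "\<And>y. (\<Sum>a\<in>T. c a * (\<Prod>j\<in>UNIV. y j ^ a j)) = 0" and "a \<in> T"
  shows "c a = 0"
proof (rule ccontr)
  assume nz: "c a \<noteq> 0"
  define T' where "T' = {a\<in>T. c a \<noteq> 0}"
  have "uniform_on (card T') UNIV (UNIV :: ('n \<Rightarrow> 'l) set)"
    unfolding uniform_on_def
  proof (intro allI impI)
    fix I :: "'n set" and j assume "j \<in> UNIV - I"
    then show "\<exists>w\<in>UNIV. (\<forall>i\<in>I. w i = (0::'l)) \<and> w j \<noteq> 0"
      by (intro bexI[of _ "\<lambda>i. if i = j then 1 else 0"]) auto
  qed
  then have "\<exists>w\<in>UNIV. (\<Sum>a\<in>T'. c a * (\<Prod>j\<in>UNIV. w j ^ a j)) \<noteq> 0"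
    using fin nz assms(4)
    by (intro few_monomials_independent[OF inf]) (auto simp: T'_def line_closed_def fun_eq_iff)
  moreover have "(\<Sum>a\<in>T'. c a * (\<Prod>j\<in>UNIV. w j ^ a j)) =
      (\<Sum>a\<in>T. c a * (\<Prod>j\<in>UNIV. w j ^ a j))" for w
    using fin by (intro sum.mono_neutral_left) (auto simp: T'_def)
  ultimately show False using zero by simp
qed

section \<open>Generic matrices\<close>

text \<open>The rows are always the first \<open>length js\<close> ones; nonvanishing of these
  minors is enough to make the row space uniform.\<close>

definition col_minor :: "'n list \<Rightarrow> (nat \<times> 'n \<Rightarrow> 'l::comm_ring_1) \<Rightarrow> 'l" where
  "col_minor js Z = det (mat (length js) (length js) (\<lambda>(a, b). Z (a, js ! b)))"

lemma line_poly_col_minor: "line_poly (col_minor js :: (nat \<times> 'n \<Rightarrow> 'l::field) \<Rightarrow> 'l)"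
proof -
  have "col_minor js = (\<lambda>Z :: nat \<times> 'n \<Rightarrow> 'l. \<Sum>p\<in>{p. p permutes {0..<length js}}.
      signof p * (\<Prod>i\<in>{0..<length js}. Z (i, js ! p i)))"
    unfolding col_minor_def det_def
    by (auto simp: fun_eq_iff intro!: sum.cong prod.cong)
  moreover have "line_poly \<dots>" by (intro line_poly_intros)
  ultimately show ?thesis by simp
qed

text \<open>A kernel vector of the transposed Vandermonde matrix is the coefficient vector of a
  nonzero polynomial of degree below \<open>length js\<close> that has \<open>length js\<close>
  distinct roots.\<close>

lemma col_minor_vandermonde:
  fixes x :: "'n \<Rightarrow> 'l::field"
  assumes "inj x" and "distinct js"
  shows "col_minor js (\<lambda>(a, j). x j ^ a) \<noteq> 0"
proof
  let ?p = "length js"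
  let ?M = "mat ?p ?p (\<lambda>(a, b). x (js ! b) ^ a)"
  assume "col_minor js (\<lambda>(a, j). x j ^ a) = 0"
  then have "det (transpose_mat ?M) = 0"
    by (simp add: col_minor_def det_transpose[of ?M ?p])
  then obtain v where v: "v \<in> carrier_vec ?p" "v \<noteq> 0\<^sub>v ?p" "transpose_mat ?M *\<^sub>v v = 0\<^sub>v ?p"
    using det_0_iff_vec_prod_zero_field[of "transpose_mat ?M" ?p] by auto
  define q where "q = (\<Sum>a<?p. monom (v $ a) a)"
  have coeff: "coeff q a = (if a < ?p then v $ a else 0)" for a
    by (simp add: q_def coeff_sum)
  have "poly q (x (js ! b)) = 0" if "b < ?p" for b
  proof -
    have "(transpose_mat ?M *\<^sub>v v) $ b = 0" using v that by simp
    then have "(\<Sum>a<?p. x (js ! b) ^ a * v $ a) = 0"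
      using that v(1) by (simp add: scalar_prod_def atLeast0LessThan)
    then show ?thesis by (simp add: q_def poly_sum poly_monom mult.commute)
  qed
  then have "x ` set js \<subseteq> {y. poly q y = 0}" by (auto simp: in_set_conv_nth)
  moreover have "q \<noteq> 0"
  proof
    assume "q = 0"
    then have "v $ a = 0" if "a < ?p" for a using coeff[of a] that by simp
    then show False using v(1,2) by auto
  qed
  ultimately have "card (x ` set js) \<le> degree q"
    using card_poly_roots_bound[of q] card_mono[OF poly_roots_finite[of q]] by (meson le_trans)
  moreover have "card (x ` set js) = ?p"
    using assms by (simp add: card_image inj_on_subset distinct_card)
  moreover have "degree q < ?p"
    using \<open>q \<noteq> 0\<close> coeff by (metis leading_coeff_0_iff)
  ultimately show False by simp
qed

section \<open>Row spaces of generic matrices\<close>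

definition row_span :: "nat \<Rightarrow> (nat \<times> 'n \<Rightarrow> 'l::field) \<Rightarrow> ('n \<Rightarrow> 'l) set" where
  "row_span k Z = {(\<lambda>j. \<Sum>l<k. w l * Z (l, j)) | w. True}"

lemma line_closed_row_span: "line_closed (row_span k Z)"
  unfolding line_closed_def row_span_def
proof clarsimp
  fix u v :: "nat \<Rightarrow> 'b" and s
  show "\<exists>w. (\<lambda>i. (\<Sum>l<k. u l * Z (l, i)) + s * ((\<Sum>l<k. v l * Z (l, i)) - (\<Sum>l<k. u l * Z (l, i)))) =
      (\<lambda>j. \<Sum>l<k. w l * Z (l, j))"
    by (rule exI[of _ "\<lambda>l. u l + s * (v l - u l)"])
      (simp add: algebra_simps sum.distrib sum_subtractf sum_distrib_left)
qed

lemma zero_in_row_span: "(\<lambda>_. 0) \<in> row_span k Z"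
  unfolding row_span_def by (auto intro!: exI[of _ "\<lambda>_. 0"])

text \<open>The leading square block on the columns of \<open>I\<close> together with
  \<open>j\<close> is invertible. A row of its inverse gives the combination of rows that is 0 on
  \<open>I\<close> and 1 at \<open>j\<close>.\<close>

lemma uniform_row_span:
  fixes Z :: "nat \<times> 'n::finite \<Rightarrow> 'l::field"
  assumes minors: "\<And>js. distinct js \<Longrightarrow> length js \<le> k \<Longrightarrow> col_minor js Z \<noteq> 0"
  shows "uniform_on k UNIV (row_span k Z)"
  unfolding uniform_on_def
proof (intro allI impI)
  fix I :: "'n set" and j assume I: "card I < k" "j \<in> UNIV - I"
  obtain bs where bs: "set bs = I" "distinct bs" using finite_distinct_list[of I] by auto
  let ?js = "bs @ [j]"
  let ?p = "length ?js"
  have p: "?p \<le> k" using bs I distinct_card by fastforce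
  let ?M = "mat ?p ?p (\<lambda>(a, b). Z (a, ?js ! b))"
  have M: "?M \<in> carrier_mat ?p ?p" by simp
  have "det ?M \<noteq> 0"
    using minors[of ?js] bs I p by (auto simp: col_minor_def)
  from det_non_zero_imp_unit[OF M this, of undefined]
  obtain B where B: "B \<in> carrier_mat ?p ?p" "B * ?M = 1\<^sub>m ?p"
    by (auto simp: Units_def ring_mat_def)
  \<comment> \<open>Column \<open>j\<close> is listed last, at index \<open>length bs\<close>, so
    that row of the inverse is the one needed. Rows of \<open>Z\<close> below the block get
    coefficient 0.\<close>
  define w where "w = (\<lambda>l. if l < ?p then B $$ (length bs, l) else 0)"
  have w: "(\<Sum>l<k. w l * Z (l, ?js ! b)) = (if b = length bs then 1 else 0)" if "b < ?p" for b
  proof -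
    have "(\<Sum>l<k. w l * Z (l, ?js ! b)) = (\<Sum>l<?p. B $$ (length bs, l) * Z (l, ?js ! b))"
      using p by (intro sum.mono_neutral_cong_right) (auto simp: w_def)
    also have "\<dots> = (B * ?M) $$ (length bs, b)"
      using that B(1) by (simp add: scalar_prod_def atLeast0LessThan)
    finally show ?thesis unfolding B(2) using that by auto
  qed
  show "\<exists>w\<in>row_span k Z. (\<forall>i\<in>I. w i = 0) \<and> w j \<noteq> 0"
  proof (intro bexI conjI ballI)
    show "(\<lambda>j. \<Sum>l<k. w l * Z (l, j)) \<in> row_span k Z" by (auto simp: row_span_def)
    show "(\<Sum>l<k. w l * Z (l, j)) \<noteq> 0" using w[of "length bs"] by simp
    fix i assume "i \<in> I"
    then obtain b where "b < length bs" "bs ! b = i" using bs by (auto simp: in_set_conv_nth)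
    then show "(\<Sum>l<k. w l * Z (l, i)) = 0" using w[of b] by (simp add: nth_append)
  qed
qed

text \<open>The product of all column minors of size at most \<open>k\<close> is nonzero at a
  Vandermonde matrix, and \<open>g\<close> is nonzero at \<open>Z0\<close>; hence both are nonzero
  at a common \<open>Z\<close>.\<close>

lemma generic_matrix:
  fixes g :: "(nat \<times> 'n::finite \<Rightarrow> 'l::field) \<Rightarrow> 'l"
  assumes inf: "infinite (UNIV :: 'l set)" and g: "line_poly g" "g Z0 \<noteq> 0"
  obtains Z where "g Z \<noteq> 0" and "uniform_on k UNIV (row_span k Z)"
proof -
  obtain x :: "'n \<Rightarrow> 'l" where x: "inj x"
  proof -
    obtain B :: "'l set" where B: "finite B" "card B = CARD('n)"
      using infinite_arbitrarily_large[OF inf, of "CARD('n)"] by blast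
    have "finite (UNIV :: 'n set)" by simp
    from card_le_inj[OF this B(1)] B(2) show thesis using that by auto
  qed
  have fin: "finite {js :: 'n list. distinct js \<and> length js \<le> k}"
    by (rule finite_subset[OF _ finite_lists_length_le[of UNIV k]]) auto
  have UN: "line_closed (UNIV :: (nat \<times> 'n \<Rightarrow> 'l) set)" by (simp add: line_closed_def)
  define h where
    "h = (\<lambda>Z :: nat \<times> 'n \<Rightarrow> 'l. \<Prod>js | distinct js \<and> length js \<le> k. col_minor js Z)"
  have h: "line_poly h" unfolding h_def by (intro line_poly_prod line_poly_col_minor)
  have hV: "h (\<lambda>(a, j). x j ^ a) \<noteq> 0"
    using col_minor_vandermonde[OF x] fin by (simp add: h_def)
  obtain Z where "g Z \<noteq> 0" "h Z \<noteq> 0"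
    using common_nonzero[where g = g and h = h and u = Z0 and v = "\<lambda>(a, j). x j ^ a",
        OF inf UN g(1) UNIV_I g(2) h UNIV_I hV] by blast
  have "uniform_on k UNIV (row_span k Z)"
  proof (rule uniform_row_span)
    fix js :: "'n list" assume "distinct js" "length js \<le> k"
    then show "col_minor js Z \<noteq> 0"
      using \<open>h Z \<noteq> 0\<close> unfolding h_def prod_zero_iff[OF fin] by blast
  qed
  then show thesis using that \<open>g Z \<noteq> 0\<close> by blast
qed

section \<open>Polynomials vanishing on matrices of bounded rank\<close>

text \<open>Products with inner dimension \<open>k\<close> parametrise the matrices of rank at most
  \<open>k\<close>. The index of \<open>Z\<close> is a pair so that \<open>line_poly\<close> applies
  to functions of \<open>Z\<close>.\<close>

abbreviation mat_mult :: "nat \<Rightarrow> ('m \<Rightarrow> nat \<Rightarrow> 'l::field) \<Rightarrow> (nat \<times> 'n \<Rightarrow> 'l) \<Rightarrow> 'm \<Rightarrow> 'n \<Rightarrow> 'l" where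
  "mat_mult k Y Z \<equiv> (\<lambda>i j. \<Sum>l<k. Y i l * Z (l, j))"

text \<open>Terms are indexed by an arbitrary set \<open>S\<close>; the term \<open>s\<close> has exponent matrix \<open>e s\<close>.\<close>

definition term_sum ::
    "'m set \<Rightarrow> 's set \<Rightarrow> ('s \<Rightarrow> 'l::field) \<Rightarrow> ('s \<Rightarrow> 'm \<Rightarrow> 'n::finite \<Rightarrow> nat) \<Rightarrow> ('m \<Rightarrow> 'n \<Rightarrow> 'l) \<Rightarrow> 'l" where
  "term_sum R S c e A = (\<Sum>s\<in>S. c s * (\<Prod>i\<in>R. \<Prod>j\<in>UNIV. A i j ^ e s i j))"

lemma term_sum_cong:
  "(\<And>i j. i \<in> R \<Longrightarrow> A i j = B i j) \<Longrightarrow> term_sum R S c e A = term_sum R S c e B"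
  unfolding term_sum_def by (intro sum.cong prod.cong arg_cong2[of _ _ _ _ "(*)"]) auto

text \<open>Grouping terms by their exponent vector \<open>\<alpha>\<close> in row \<open>r\<close>
  exhibits the sum as a polynomial in that row, with coefficients depending only on the rows in
  \<open>R\<close>.\<close>

lemma term_sum_insert_row:
  fixes S :: "'s set"
  assumes "finite S" and "finite R" and "r \<notin> R"
  shows "term_sum (insert r R) S c e A =
    (\<Sum>\<alpha>\<in>(\<lambda>s. e s r) ` S. term_sum R {s\<in>S. e s r = \<alpha>} c e A * (\<Prod>j\<in>UNIV. A r j ^ \<alpha> j))"
proof -
  have "term_sum (insert r R) S c e A = (\<Sum>\<alpha>\<in>(\<lambda>s. e s r) ` S. \<Sum>s\<in>{s\<in>S. e s r = \<alpha>}.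
      c s * ((\<Prod>j\<in>UNIV. A r j ^ e s r j) * (\<Prod>i\<in>R. \<Prod>j\<in>UNIV. A i j ^ e s i j)))"
    using assms unfolding term_sum_def by (subst sum.image_gen[OF assms(1), of _ "\<lambda>s. e s r"]) simp
  also have "\<dots> = (\<Sum>\<alpha>\<in>(\<lambda>s. e s r) ` S.
      term_sum R {s\<in>S. e s r = \<alpha>} c e A * (\<Prod>j\<in>UNIV. A r j ^ \<alpha> j))"
    unfolding term_sum_def sum_distrib_right by (intro sum.cong) (auto simp: mult_ac)
  finally show ?thesis .
qed

text \<open>The outer induction on \<open>k\<close> lowers the rank, the inner one on
  \<open>R\<close> removes rows. Both recurse to a fibre of \<open>S\<close> with the same
  \<open>c\<close> and \<open>e\<close>: terms that agree in the removed row must still differ in a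
  remaining one.\<close>

lemma many_terms:
  fixes c :: "'s \<Rightarrow> 'l::field" and e :: "'s \<Rightarrow> 'm \<Rightarrow> 'n::finite \<Rightarrow> nat"
  assumes inf: "infinite (UNIV :: 'l set)"
    and "finite R" and "finite S" and "S \<noteq> {}"
    and "\<And>s. s \<in> S \<Longrightarrow> c s \<noteq> 0"
    and "\<And>s s'. s \<in> S \<Longrightarrow> s' \<in> S \<Longrightarrow> s \<noteq> s' \<Longrightarrow> \<exists>i\<in>R. e s i \<noteq> e s' i"
    and "\<And>Y Z. term_sum R S c e (mat_mult k Y Z) = 0"
  shows "fact (Suc k) \<le> card S"
  using assms(2-)
proof (induction k arbitrary: R S)
  case 0
  then have "card S > 0" by (simp add: card_gt_0_iff)
  then show ?case by simp
next
  case (Suc k)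
  note outer = Suc.IH
  show ?case
    using Suc.prems
  proof (induction R arbitrary: S)
    \<comment> \<open>Without rows at most one term is left, and its value is its nonzero
      coefficient.\<close>
    case empty
    then obtain s where "S = {s}" by (metis all_not_in_conv is_singletonI' is_singleton_the_elem)
    then show ?case using empty.prems(3,5) by (simp add: term_sum_def)
  next
    case (insert r R)
    note fS = insert.prems(1) and fR = insert.hyps(1) and rR = insert.hyps(2)
    define T where "T = (\<lambda>s. e s r) ` S"
    define P where "P = (\<lambda>\<alpha>. {s\<in>S. e s r = \<alpha>})"
    define f where "f = (\<lambda>\<alpha>. term_sum R (P \<alpha>) c e)"
    have fT: "finite T" using fS by (simp add: T_def)
    have fP: "finite (P \<alpha>)" for \<alpha> using fS by (simp add: P_def)
    have neP: "P \<alpha> \<noteq> {}" if "\<alpha> \<in> T" for \<alpha> using that by (auto simp: P_def T_def)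
    have cP: "c s \<noteq> 0" if "s \<in> P \<alpha>" for s \<alpha> using that insert.prems(3) by (auto simp: P_def)
    have distP: "\<exists>i\<in>R. e s i \<noteq> e s' i" if "s \<in> P \<alpha>" "s' \<in> P \<alpha>" "s \<noteq> s'" for s s' \<alpha>
      using insert.prems(4)[of s s'] that by (auto simp: P_def)
    have expand: "term_sum (insert r R) S c e A = (\<Sum>\<alpha>\<in>T. f \<alpha> A * (\<Prod>j\<in>UNIV. A r j ^ \<alpha> j))" for A
      unfolding term_sum_insert_row[OF fS fR rR] T_def f_def P_def ..
    show ?case
    proof (cases "\<forall>\<alpha>\<in>T. \<forall>Y Z. f \<alpha> (mat_mult (Suc k) Y Z) = 0")
      case True
      obtain \<alpha> where \<alpha>: "\<alpha> \<in> T" using insert.prems(2) by (auto simp: T_def)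
      have "fact (Suc (Suc k)) \<le> card (P \<alpha>)"
        using True \<alpha> by (intro insert.IH fP neP cP distP) (auto simp: f_def)
      also have "\<dots> \<le> card S" using fS by (intro card_mono) (auto simp: P_def)
      finally show ?thesis .
    next
      case False
      then obtain \<alpha>0 Y Z0 where \<alpha>0: "\<alpha>0 \<in> T" "f \<alpha>0 (mat_mult (Suc k) Y Z0) \<noteq> 0" by auto
      \<comment> \<open>With \<open>Y\<close> fixed, the nonvanishing is a polynomial condition on
        \<open>Z\<close>, so \<open>Z\<close> can be made generic without losing it.\<close>
      have "line_poly (\<lambda>Z. f \<alpha>0 (mat_mult (Suc k) Y Z))"
        unfolding f_def term_sum_def by (intro line_poly_intros)
      from generic_matrix[OF inf this \<alpha>0(2), of "Suc k"]
      obtain Z where Z: "f \<alpha>0 (mat_mult (Suc k) Y Z) \<noteq> 0"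
        and U: "uniform_on (Suc k) UNIV (row_span (Suc k) Z)" .
      define d where "d = (\<lambda>\<alpha>. f \<alpha> (mat_mult (Suc k) Y Z))"
      define T' where "T' = {\<alpha>\<in>T. d \<alpha> \<noteq> 0}"
      \<comment> \<open>Any \<open>y\<close> in the row space becomes row \<open>r\<close> of the
        product once row \<open>r\<close> of \<open>Y\<close> is replaced by the coefficients of
        \<open>y\<close>. The values \<open>d \<alpha>\<close> do not change, since they do not see
        row \<open>r\<close>.\<close>
      have "(\<Sum>\<alpha>\<in>T'. d \<alpha> * (\<Prod>j\<in>UNIV. y j ^ \<alpha> j)) = 0" if y: "y \<in> row_span (Suc k) Z" for y
      proof -
        obtain w where w: "y = (\<lambda>j. \<Sum>l<Suc k. w l * Z (l, j))"
          using y by (auto simp: row_span_def)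
        have "(\<Sum>\<alpha>\<in>T'. d \<alpha> * (\<Prod>j\<in>UNIV. y j ^ \<alpha> j)) = (\<Sum>\<alpha>\<in>T. d \<alpha> * (\<Prod>j\<in>UNIV. y j ^ \<alpha> j))"
          using fT by (intro sum.mono_neutral_left) (auto simp: T'_def)
        also have "\<dots> = (\<Sum>\<alpha>\<in>T. f \<alpha> (mat_mult (Suc k) (Y(r := w)) Z) *
            (\<Prod>j\<in>UNIV. mat_mult (Suc k) (Y(r := w)) Z r j ^ \<alpha> j))"
        proof (rule sum.cong)
          fix \<alpha>
          have "d \<alpha> = f \<alpha> (mat_mult (Suc k) (Y(r := w)) Z)"
            unfolding d_def f_def using rR by (intro term_sum_cong) auto
          then show "d \<alpha> * (\<Prod>j\<in>UNIV. y j ^ \<alpha> j) = f \<alpha> (mat_mult (Suc k) (Y(r := w)) Z) *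
              (\<Prod>j\<in>UNIV. mat_mult (Suc k) (Y(r := w)) Z r j ^ \<alpha> j)"
            by (simp add: w)
        qed simp
        also have "\<dots> = 0" unfolding expand[of "mat_mult (Suc k) (Y(r := w)) Z", symmetric]
          by (rule insert.prems(5))
        finally show ?thesis .
      qed
      then have "\<not> card T' \<le> Suc k"
        using few_monomials_independent[OF inf finite line_closed_row_span zero_in_row_span U,
            of T' d] \<alpha>0(1) Z fT by (auto simp: T'_def d_def fun_eq_iff)
      then have "Suc (Suc k) \<le> card T'" by simp
      also have "\<dots> \<le> card T" using fT by (intro card_mono) (auto simp: T'_def)
      finally have cardT: "Suc (Suc k) \<le> card T" .
      have small: "fact (Suc k) \<le> card (P \<alpha>)" if \<alpha>: "\<alpha> \<in> T" for \<alpha>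
      proof (rule outer[OF fR fP neP[OF \<alpha>] cP distP])
        fix Y :: "'m \<Rightarrow> nat \<Rightarrow> 'l" and Z :: "nat \<times> 'n \<Rightarrow> 'l"
        have "(\<Sum>\<alpha>\<in>T. f \<alpha> (mat_mult k Y Z) * (\<Prod>j\<in>UNIV. y j ^ \<alpha> j)) = 0" for y
        proof -
          \<comment> \<open>The row \<open>y\<close> is appended to \<open>Z\<close>, and only row
            \<open>r\<close> uses it. Thus a product of inner dimension \<open>k\<close> on the rows
            \<open>R\<close>, completed by an arbitrary row \<open>y\<close>, is a product of inner
            dimension \<open>Suc k\<close>.\<close>
          define Y' where
            "Y' = (\<lambda>i l. if i = r then if l = k then 1 else 0 else if l = k then 0 else Y i l)"
          define Z' where "Z' = (\<lambda>(l, j). if l = k then y j else Z (l, j))"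
          have "(\<Sum>l<k. Y' r l * Z' (l, j)) = 0" for j
            by (rule sum.neutral) (auto simp: Y'_def)
          then have row: "mat_mult (Suc k) Y' Z' r j = y j" for j
            by (simp add: Y'_def Z'_def)
          have "(\<Sum>l<k. Y' i l * Z' (l, j)) = mat_mult k Y Z i j" if "i \<noteq> r" for i j
            using that by (intro sum.cong) (auto simp: Y'_def Z'_def)
          then have other: "mat_mult (Suc k) Y' Z' i j = mat_mult k Y Z i j" if "i \<noteq> r" for i j
            using that by (simp add: Y'_def)
          have "f \<alpha> (mat_mult (Suc k) Y' Z') = f \<alpha> (mat_mult k Y Z)" for \<alpha>
            unfolding f_def using rR other by (intro term_sum_cong) metis
          then show ?thesis
            using expand[of "mat_mult (Suc k) Y' Z'"] insert.prems(5)[of Y' Z']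
            by (simp only: row)
        qed
        from monomials_independent[OF inf fT this \<alpha>]
        show "term_sum R (P \<alpha>) c e (mat_mult k Y Z) = 0" by (simp add: f_def)
      qed
      have "fact (Suc (Suc k)) = Suc (Suc k) * (fact (Suc k) :: nat)" by simp
      also have "\<dots> \<le> card T * fact (Suc k)" using cardT by (intro mult_right_mono) auto
      also have "\<dots> \<le> (\<Sum>\<alpha>\<in>T. card (P \<alpha>))"
        using sum_bounded_below[of T "fact (Suc k)" "\<lambda>\<alpha>. card (P \<alpha>)"] small by simp
      also have "\<dots> = card (\<Union>\<alpha>\<in>T. P \<alpha>)"
        using fT fP by (intro card_UN_disjoint[symmetric]) (auto simp: P_def)
      also have "(\<Union>\<alpha>\<in>T. P \<alpha>) = S" by (auto simp: P_def T_def)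
      finally show ?thesis .
    qed
  qed
qed

section \<open>Evaluation of polynomials\<close>

text \<open>The monomials of \<open>p\<close> index their own terms in \<open>term_sum\<close>, so a
  vanishing evaluation has the form that \<open>many_terms\<close> asks for.\<close>

definition eval_at ::
    "('k \<Rightarrow> 'l) \<Rightarrow> ('m \<Rightarrow> 'n \<Rightarrow> 'l) \<Rightarrow> ('m::finite, 'n::finite, 'k::comm_ring_1) mpoly \<Rightarrow> 'l::field" where
  "eval_at \<phi> A p = term_sum UNIV (Poly_Mapping.keys p) (\<lambda>a. \<phi> (Poly_Mapping.lookup p a))
    (\<lambda>a i j. Poly_Mapping.lookup a (i, j)) A"

lemma poly_mapping_sum_single:
  "p = (\<Sum>a\<in>Poly_Mapping.keys p. Poly_Mapping.single a (Poly_Mapping.lookup p a))"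
proof (rule poly_mapping_eqI)
  fix a
  show "Poly_Mapping.lookup p a = Poly_Mapping.lookup
      (\<Sum>a\<in>Poly_Mapping.keys p. Poly_Mapping.single a (Poly_Mapping.lookup p a)) a"
    by (simp add: lookup_sum lookup_single when_def in_keys_iff)
qed

context
  fixes \<phi> :: "'k::comm_ring_1 \<Rightarrow> 'l::field" and A :: "'m::finite \<Rightarrow> 'n::finite \<Rightarrow> 'l"
  assumes hom: "comm_ring_hom \<phi>"
begin

interpretation \<phi>: comm_ring_hom \<phi> by (rule hom)

lemma eval_at_single:
  "eval_at \<phi> A (Poly_Mapping.single a c) =
    \<phi> c * (\<Prod>i\<in>UNIV. \<Prod>j\<in>UNIV. A i j ^ Poly_Mapping.lookup a (i, j))"
  by (cases "c = 0") (simp_all add: eval_at_def term_sum_def)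

lemma eval_at_add: "eval_at \<phi> A (p + q) = eval_at \<phi> A p + eval_at \<phi> A q"
  unfolding eval_at_def term_sum_def
  by (rule setsum_keys_plus_distrib) (simp_all add: \<phi>.hom_add distrib_right)

lemma eval_at_zero: "eval_at \<phi> A 0 = 0"
  by (simp add: eval_at_def term_sum_def)

lemma eval_at_sum: "eval_at \<phi> A (\<Sum>x\<in>X. f x) = (\<Sum>x\<in>X. eval_at \<phi> A (f x))"
  by (induction X rule: infinite_finite_induct) (simp_all add: eval_at_zero eval_at_add)

lemma eval_at_single_mult:
  "eval_at \<phi> A (Poly_Mapping.single a c * Poly_Mapping.single b d) =
    eval_at \<phi> A (Poly_Mapping.single a c) * eval_at \<phi> A (Poly_Mapping.single b d)"
  by (simp add: mult_single eval_at_single \<phi>.hom_mult lookup_add power_add prod.distrib mult_ac)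

text \<open>Distributivity reduces the claim to single terms, so cancellation among the monomials of
  \<open>p * q\<close> need not be tracked.\<close>

lemma eval_at_mult: "eval_at \<phi> A (p * q) = eval_at \<phi> A p * eval_at \<phi> A q"
proof -
  define P where "P = (\<lambda>p :: ('m, 'n, 'k) mpoly. \<lambda>a. Poly_Mapping.single a (Poly_Mapping.lookup p a))"
  have P: "p = (\<Sum>a\<in>Poly_Mapping.keys p. P p a)" for p
    unfolding P_def by (rule poly_mapping_sum_single)
  have "eval_at \<phi> A (p * q) =
      eval_at \<phi> A ((\<Sum>a\<in>Poly_Mapping.keys p. P p a) * (\<Sum>b\<in>Poly_Mapping.keys q. P q b))"
    by (simp flip: P)
  also have "\<dots> = eval_at \<phi> A (\<Sum>a\<in>Poly_Mapping.keys p. P p a) *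
      eval_at \<phi> A (\<Sum>b\<in>Poly_Mapping.keys q. P q b)"
    unfolding sum_product eval_at_sum by (simp add: P_def eval_at_single_mult)
  finally show ?thesis by (simp flip: P)
qed

lemma comm_ring_hom_eval_at: "comm_ring_hom (eval_at \<phi> A)"
proof
  show "eval_at \<phi> A 1 = 1"
    using eval_at_single[of 0 1] by simp
qed (simp_all add: eval_at_zero eval_at_add eval_at_mult)

lemma eval_at_var: "eval_at \<phi> A (var i j) = A i j"
proof -
  have "(\<Prod>i'\<in>UNIV. \<Prod>j'\<in>UNIV. A i' j' ^ Poly_Mapping.lookup (Poly_Mapping.single (i, j) 1) (i', j')) =
      (\<Prod>i'\<in>UNIV. if i' = i then A i j else 1)"
  proof (rule prod.cong)
    fix i'
    have "(\<Prod>j'\<in>UNIV. A i' j' ^ Poly_Mapping.lookup (Poly_Mapping.single (i, j) 1) (i', j')) =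
        (\<Prod>j'\<in>UNIV. if j' = j then (if i' = i then A i j else 1) else 1)"
      by (rule prod.cong) (auto simp: lookup_single)
    then show "(\<Prod>j'\<in>UNIV. A i' j' ^ Poly_Mapping.lookup (Poly_Mapping.single (i, j) 1) (i', j')) =
        (if i' = i then A i j else 1)" by simp
  qed simp
  then show ?thesis by (simp add: var_def eval_at_single)
qed

lemma eval_at_minor:
  "eval_at \<phi> A (minor t r c) = det (mat t t (\<lambda>(a, b). A (r a) (c b)))"
proof -
  interpret comm_ring_hom "eval_at \<phi> A" by (rule comm_ring_hom_eval_at)
  have "map_mat (eval_at \<phi> A) (mat t t (\<lambda>(a, b). var (r a) (c b))) =
      mat t t (\<lambda>(a, b). A (r a) (c b))"
    by (rule eq_matI) (simp_all add: eval_at_var)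
  then show ?thesis unfolding minor_def hom_det[symmetric] by simp
qed

end

section \<open>Vanishing of the ideal on matrices of bounded rank\<close>

text \<open>Both factors are padded to square matrices. The row added to \<open>Z\<close> is zero,
  so its determinant vanishes and the column added to \<open>Y\<close> contributes nothing to the
  product.\<close>

lemma det_mat_mult_zero:
  fixes Y :: "'m \<Rightarrow> nat \<Rightarrow> 'l::field" and Z :: "nat \<times> 'n \<Rightarrow> 'l"
  shows "det (mat (Suc k) (Suc k) (\<lambda>(a, b). mat_mult k Y Z (r a) (c b))) = 0"
proof -
  let ?n = "Suc k"
  let ?Y = "mat ?n ?n (\<lambda>(a, l). Y (r a) l)"
  let ?Z = "mat\<^sub>r ?n ?n (\<lambda>l. if l = k then 0\<^sub>v ?n else vec ?n (\<lambda>b. Z (l, c b)))"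
  have "mat ?n ?n (\<lambda>(a, b). mat_mult k Y Z (r a) (c b)) = ?Y * ?Z"
  proof (rule eq_matI)
    fix a b assume "a < dim_row (?Y * ?Z)" "b < dim_col (?Y * ?Z)"
    then have "a < ?n" "b < ?n" by auto
    then show "mat ?n ?n (\<lambda>(a, b). mat_mult k Y Z (r a) (c b)) $$ (a, b) = (?Y * ?Z) $$ (a, b)"
      by (simp add: scalar_prod_def atLeast0LessThan)
  qed auto
  also have "det \<dots> = det ?Y * det ?Z" by (rule det_mult) auto
  also have "det ?Z = 0" by (rule det_row_0) auto
  finally show ?thesis by simp
qed

lemma eval_at_determinantal_ideal:
  fixes p :: "('m::finite, 'n::finite, 'k::comm_ring_1) mpoly" and \<phi> :: "'k \<Rightarrow> 'l::field"
  assumes hom: "comm_ring_hom \<phi>" and p: "p \<in> gen_ideal (minors (Suc k))"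
  shows "eval_at \<phi> (mat_mult k Y Z) p = 0"
proof -
  obtain F h where F: "F \<subseteq> minors (Suc k)" "p = (\<Sum>g\<in>F. h g * g)"
    using p by (auto simp: gen_ideal_def)
  have "eval_at \<phi> (mat_mult k Y Z) g = 0" if g: "g \<in> F" for g
  proof -
    obtain r c where "g = minor (Suc k) r c" using g F(1) by (auto simp: minors_def)
    then show ?thesis by (simp only: eval_at_minor[OF hom] det_mat_mult_zero)
  qed
  then show ?thesis unfolding F(2) by (simp add: eval_at_sum[OF hom] eval_at_mult[OF hom])
qed

section \<open>Passage to an infinite extension field and conclusion\<close>

text \<open>The given field may be finite, so evaluation takes place in its field of rational
  functions, where the powers of the variable are distinct.\<close>

lemma infinite_UNIV_poly_fract: "infinite (UNIV :: 'k::field poly fract set)"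
proof -
  have "inj (\<lambda>n. to_fract (monom (1::'k) n))"
    by (auto intro!: injI simp: to_fract_eq_iff monom_eq_iff')
  then show ?thesis using infinite_UNIV_nat finite_imageD infinite_super subset_UNIV by metis
qed

lemma comm_ring_hom_const_fract: "comm_ring_hom (\<lambda>c::'k::field. to_fract [:c:])"
  by standard (simp_all flip: to_fract_add to_fract_mult add: pCons_one)

theorem theorem3p1:
  fixes t :: nat and p :: "('m::finite, 'n::finite, 'k::field) mpoly"
  assumes "0 < t" and "t \<le> CARD('m)" and "t \<le> CARD('n)"
    and "p \<in> gen_ideal (minors t)" and "p \<noteq> 0"
  shows "real (num_terms p) > fact t / 2"
proof -
  obtain k where k: "t = Suc k" using assms(1) gr0_conv_Suc by auto
  \<comment> \<open>The constant embedding keeps nonzero coefficients nonzero, so the terms of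
    \<open>p\<close> satisfy the hypotheses of \<open>many_terms\<close>. The resulting bound
    \<open>fact t\<close> exceeds the claimed \<open>fact t / 2\<close>.\<close>
  have "fact (Suc k) \<le> card (Poly_Mapping.keys p)"
  proof (rule many_terms[OF infinite_UNIV_poly_fract, where R = "UNIV :: 'm set"
        and c = "\<lambda>a. to_fract [:Poly_Mapping.lookup p a:]"
        and e = "\<lambda>a i (j::'n). Poly_Mapping.lookup a (i, j)"])
    fix a b :: "'m \<times> 'n \<Rightarrow>\<^sub>0 nat" assume "a \<noteq> b"
    then show "\<exists>i\<in>UNIV. (\<lambda>j. Poly_Mapping.lookup a (i, j)) \<noteq> (\<lambda>j. Poly_Mapping.lookup b (i, j))"
      by (auto simp: poly_mapping_eq_iff fun_eq_iff)
  next
    fix Y :: "'m \<Rightarrow> nat \<Rightarrow> 'k poly fract" and Z :: "nat \<times> 'n \<Rightarrow> 'k poly fract"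
    show "term_sum UNIV (Poly_Mapping.keys p) (\<lambda>a. to_fract [:Poly_Mapping.lookup p a:])
        (\<lambda>a i j. Poly_Mapping.lookup a (i, j)) (mat_mult k Y Z) = 0"
      using eval_at_determinantal_ideal[OF comm_ring_hom_const_fract, of p k Y Z] assms(4)
      by (simp add: k eval_at_def)
  qed (use assms(5) in \<open>auto simp: in_keys_iff\<close>)
  then have "fact t \<le> num_terms p" by (simp only: k num_terms_def)
  then have "fact t \<le> real (num_terms p)" by (metis of_nat_fact of_nat_le_iff)
  moreover have "(0::real) < fact t" by simp
  ultimately show ?thesis by linarith
qed

end
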